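(* Let $S_1$ and $S_2$ be rings, let $M$ be any $(S_1,S_2)$-bimodule, and let $T = \begin{pmatrix} S_1 & M \\ 0 & S_2 \end{pmatrix}$ be the formal triangular ring. Then the following hold: (1) For any $n \geq 2$, the ring $T$ satisfies Property $K_n$ if and only if both $S_1$ and $S_2$ satisfy Property $K_n$. (2) For any $n \geq 2$, the ring $T$ satisfies Property $\overline{K_n}$ if and only if both $S_1$ and $S_2$ satisfy Property $\overline{K_n}$.
   Context: Rings are associative with unity, not necessarily commutative. The formal triangular ring $T$ consists of the formal matrices $\begin{pmatrix} r & m \\ 0 & s\end{pmatrix}$ with $r \in S_1$, $m \in M$, $s \in S_2$, with the usual matrix addition and multiplication. An element $x$ of a ring is $n$-potent if $x^n = x$. For elements $a,b$ of a ring and an integer $n \geq 2$: $\langle a,b\rangle_n := (a+b)^n - a^n - b^n$, $[a,b]_n^L := (a-b)(a+b)^{n-1} - (a^n - b^n)$, and $[a,b]_n^R := (a+b)^{n-1}(a-b) - (a^n-b^n)$. A ring $R$ satisfies Property $K_n$ if there exist $n$-potent elements $a,b \in R$ such that $[a,b]_n^L$ and $[a,b]_n^R$ are both units in $R$. A ring $R$ satisfies Property $\overline{K_n}$ if there exist $n$-potent elements $a,b \in R$ such that $\langle a,b\rangle_n$ is a unit in $R$. *)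

theory Defs
  imports "HOL-Algebra.Module"
begin

definition n_potent :: "('a, 'x) ring_scheme \<Rightarrow> nat \<Rightarrow> 'a \<Rightarrow> bool" where
  "n_potent R n x \<longleftrightarrow> x \<in> carrier R \<and> x [^]\<^bsub>R\<^esub> n = x"

definition angle_bracket :: "('a, 'x) ring_scheme \<Rightarrow> nat \<Rightarrow> 'a \<Rightarrow> 'a \<Rightarrow> 'a" where
  "angle_bracket R n a b =
     (a \<oplus>\<^bsub>R\<^esub> b) [^]\<^bsub>R\<^esub> n \<ominus>\<^bsub>R\<^esub> a [^]\<^bsub>R\<^esub> n \<ominus>\<^bsub>R\<^esub> b [^]\<^bsub>R\<^esub> n"

definition left_bracket :: "('a, 'x) ring_scheme \<Rightarrow> nat \<Rightarrow> 'a \<Rightarrow> 'a \<Rightarrow> 'a" where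
  "left_bracket R n a b =
     (a \<ominus>\<^bsub>R\<^esub> b) \<otimes>\<^bsub>R\<^esub> (a \<oplus>\<^bsub>R\<^esub> b) [^]\<^bsub>R\<^esub> (n - 1)
       \<ominus>\<^bsub>R\<^esub> (a [^]\<^bsub>R\<^esub> n \<ominus>\<^bsub>R\<^esub> b [^]\<^bsub>R\<^esub> n)"

definition right_bracket :: "('a, 'x) ring_scheme \<Rightarrow> nat \<Rightarrow> 'a \<Rightarrow> 'a \<Rightarrow> 'a" where
  "right_bracket R n a b =
     (a \<oplus>\<^bsub>R\<^esub> b) [^]\<^bsub>R\<^esub> (n - 1) \<otimes>\<^bsub>R\<^esub> (a \<ominus>\<^bsub>R\<^esub> b)
       \<ominus>\<^bsub>R\<^esub> (a [^]\<^bsub>R\<^esub> n \<ominus>\<^bsub>R\<^esub> b [^]\<^bsub>R\<^esub> n)"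

definition property_K :: "('a, 'x) ring_scheme \<Rightarrow> nat \<Rightarrow> bool" where
  "property_K R n \<longleftrightarrow>
     (\<exists>a b. n_potent R n a \<and> n_potent R n b \<and>
        left_bracket R n a b \<in> Units R \<and> right_bracket R n a b \<in> Units R)"

definition property_K_bar :: "('a, 'x) ring_scheme \<Rightarrow> nat \<Rightarrow> bool" where
  "property_K_bar R n \<longleftrightarrow>
     (\<exists>a b. n_potent R n a \<and> n_potent R n b \<and> angle_bracket R n a b \<in> Units R)"

(* HOL-Algebra modules are one-sided and over commutative rings, so only the record type is
   reused: \<odot> is the left action and rsmult the right action. As for HOL-Algebra modules, the
   mult and one fields of the record are irrelevant junk. *)
record ('a, 'b, 'm) bimodule = "('a, 'm) module" +
  rsmult :: "'m \<Rightarrow> 'b \<Rightarrow> 'm"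

locale bimodule = S1: ring S1 + S2: ring S2 + M: abelian_group M
  for S1 :: "('a, 'x) ring_scheme"
    and S2 :: "('b, 'y) ring_scheme"
    and M :: "('a, 'b, 'm, 'z) bimodule_scheme" +
  assumes smult_closed:
      "\<lbrakk>r \<in> carrier S1; m \<in> carrier M\<rbrakk> \<Longrightarrow> r \<odot>\<^bsub>M\<^esub> m \<in> carrier M"
    and smult_l_distr:
      "\<lbrakk>r \<in> carrier S1; r' \<in> carrier S1; m \<in> carrier M\<rbrakk>
        \<Longrightarrow> (r \<oplus>\<^bsub>S1\<^esub> r') \<odot>\<^bsub>M\<^esub> m = r \<odot>\<^bsub>M\<^esub> m \<oplus>\<^bsub>M\<^esub> r' \<odot>\<^bsub>M\<^esub> m"
    and smult_r_distr:
      "\<lbrakk>r \<in> carrier S1; m \<in> carrier M; m' \<in> carrier M\<rbrakk>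
        \<Longrightarrow> r \<odot>\<^bsub>M\<^esub> (m \<oplus>\<^bsub>M\<^esub> m') = r \<odot>\<^bsub>M\<^esub> m \<oplus>\<^bsub>M\<^esub> r \<odot>\<^bsub>M\<^esub> m'"
    and smult_assoc:
      "\<lbrakk>r \<in> carrier S1; r' \<in> carrier S1; m \<in> carrier M\<rbrakk>
        \<Longrightarrow> (r \<otimes>\<^bsub>S1\<^esub> r') \<odot>\<^bsub>M\<^esub> m = r \<odot>\<^bsub>M\<^esub> (r' \<odot>\<^bsub>M\<^esub> m)"
    and smult_one:
      "m \<in> carrier M \<Longrightarrow> \<one>\<^bsub>S1\<^esub> \<odot>\<^bsub>M\<^esub> m = m"
    and rsmult_closed:
      "\<lbrakk>m \<in> carrier M; s \<in> carrier S2\<rbrakk> \<Longrightarrow> rsmult M m s \<in> carrier M"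
    and rsmult_l_distr:
      "\<lbrakk>m \<in> carrier M; m' \<in> carrier M; s \<in> carrier S2\<rbrakk>
        \<Longrightarrow> rsmult M (m \<oplus>\<^bsub>M\<^esub> m') s = rsmult M m s \<oplus>\<^bsub>M\<^esub> rsmult M m' s"
    and rsmult_r_distr:
      "\<lbrakk>m \<in> carrier M; s \<in> carrier S2; s' \<in> carrier S2\<rbrakk>
        \<Longrightarrow> rsmult M m (s \<oplus>\<^bsub>S2\<^esub> s') = rsmult M m s \<oplus>\<^bsub>M\<^esub> rsmult M m s'"
    and rsmult_assoc:
      "\<lbrakk>m \<in> carrier M; s \<in> carrier S2; s' \<in> carrier S2\<rbrakk>
        \<Longrightarrow> rsmult M m (s \<otimes>\<^bsub>S2\<^esub> s') = rsmult M (rsmult M m s) s'"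
    and rsmult_one:
      "m \<in> carrier M \<Longrightarrow> rsmult M m \<one>\<^bsub>S2\<^esub> = m"
    and smult_rsmult:
      "\<lbrakk>r \<in> carrier S1; m \<in> carrier M; s \<in> carrier S2\<rbrakk>
        \<Longrightarrow> rsmult M (r \<odot>\<^bsub>M\<^esub> m) s = r \<odot>\<^bsub>M\<^esub> rsmult M m s"

(* The triple (r, m, s) stands for the formal matrix with rows (r, m) and (0, s). *)
definition triangular_ring ::
  "('a, 'x) ring_scheme \<Rightarrow> ('a, 'b, 'm, 'z) bimodule_scheme \<Rightarrow> ('b, 'y) ring_scheme
     \<Rightarrow> ('a \<times> 'm \<times> 'b) ring" where
  "triangular_ring S1 M S2 =
     \<lparr>carrier = carrier S1 \<times> carrier M \<times> carrier S2,
      mult = (\<lambda>(r, m, s) (r', m', s').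
        (r \<otimes>\<^bsub>S1\<^esub> r', r \<odot>\<^bsub>M\<^esub> m' \<oplus>\<^bsub>M\<^esub> rsmult M m s', s \<otimes>\<^bsub>S2\<^esub> s')),
      one = (\<one>\<^bsub>S1\<^esub>, \<zero>\<^bsub>M\<^esub>, \<one>\<^bsub>S2\<^esub>),
      zero = (\<zero>\<^bsub>S1\<^esub>, \<zero>\<^bsub>M\<^esub>, \<zero>\<^bsub>S2\<^esub>),
      add = (\<lambda>(r, m, s) (r', m', s').
        (r \<oplus>\<^bsub>S1\<^esub> r', m \<oplus>\<^bsub>M\<^esub> m', s \<oplus>\<^bsub>S2\<^esub> s'))\<rparr>"

context bimodule
begin

lemma smult_zero:
  assumes "r \<in> carrier S1" shows "r \<odot>\<^bsub>M\<^esub> \<zero>\<^bsub>M\<^esub> = \<zero>\<^bsub>M\<^esub>"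
  using smult_r_distr[OF assms M.zero_closed M.zero_closed] smult_closed[OF assms M.zero_closed]
  by (metis M.add.l_cancel_one' M.l_zero M.zero_closed)

lemma rsmult_zero:
  assumes "s \<in> carrier S2" shows "rsmult M \<zero>\<^bsub>M\<^esub> s = \<zero>\<^bsub>M\<^esub>"
  using rsmult_l_distr[OF M.zero_closed M.zero_closed assms] rsmult_closed[OF M.zero_closed assms]
  by (metis M.add.l_cancel_one' M.l_zero M.zero_closed)

lemma ring_triangular_ring: "ring (triangular_ring S1 M S2)"
proof (rule ringI)
  show "abelian_group (triangular_ring S1 M S2)"
  proof (rule abelian_groupI)
    fix x assume "x \<in> carrier (triangular_ring S1 M S2)"
    then obtain r m s where x: "x = (r, m, s)"
      "r \<in> carrier S1" "m \<in> carrier M" "s \<in> carrier S2"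
      by (auto simp: triangular_ring_def)
    show "\<exists>y\<in>carrier (triangular_ring S1 M S2).
        y \<oplus>\<^bsub>triangular_ring S1 M S2\<^esub> x = \<zero>\<^bsub>triangular_ring S1 M S2\<^esub>"
      by (rule bexI[of _ "(\<ominus>\<^bsub>S1\<^esub> r, \<ominus>\<^bsub>M\<^esub> m, \<ominus>\<^bsub>S2\<^esub> s)"])
        (auto simp: x triangular_ring_def S1.l_neg S2.l_neg M.l_neg)
  qed (auto simp: triangular_ring_def S1.a_ac S2.a_ac M.a_ac)
  show "Group.monoid (triangular_ring S1 M S2)"
    by (rule monoidI)
      (auto simp: triangular_ring_def smult_closed rsmult_closed smult_zero rsmult_zero
        smult_one rsmult_one smult_r_distr rsmult_l_distr smult_assoc rsmult_assoc smult_rsmult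
        S1.m_assoc S2.m_assoc M.a_assoc)
qed (auto simp: triangular_ring_def smult_closed rsmult_closed smult_l_distr smult_r_distr
    rsmult_l_distr rsmult_r_distr S1.l_distr S1.r_distr S2.l_distr S2.r_distr M.a_ac)

end

end

theory Submission
  imports Defs "HOL-Algebra.RingHom"
begin

text \<open>
  The two diagonal entries of a formal triangular matrix give ring homomorphisms from the
  triangular ring \<open>T\<close> onto \<open>S1\<close> and \<open>S2\<close>. Homomorphisms preserve \<open>n\<close>-potency, units and the three
  brackets, so a pair witnessing one of the properties in \<open>T\<close> projects to witnesses in \<open>S1\<close> and
  in \<open>S2\<close>.

  Conversely, witnesses \<open>a1, b1\<close> and \<open>a2, b2\<close> in the two rings are put on the diagonal:
  \<open>(a1, 0, a2)\<close> and \<open>(b1, 0, b2)\<close>. Powers of diagonal matrices are computed entrywise, whence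
  \<open>n\<close>-potency. Nothing has to be known about the off-diagonal entry of a bracket in \<open>T\<close>: a
  triangular matrix is invertible as soon as its two diagonal entries are
  (\<open>Units_triangular_ring_iff\<close>), and by the homomorphism argument the diagonal entries of the
  bracket are the brackets in \<open>S1\<close> and \<open>S2\<close>.
\<close>

lemma (in ring) angle_bracket_closed:
  assumes "a \<in> carrier R" "b \<in> carrier R"
  shows "angle_bracket R n a b \<in> carrier R"
  using assms by (simp add: angle_bracket_def)

lemma (in ring) left_bracket_closed:
  assumes "a \<in> carrier R" "b \<in> carrier R"
  shows "left_bracket R n a b \<in> carrier R"
  using assms by (simp add: left_bracket_def)

lemma (in ring) right_bracket_closed:
  assumes "a \<in> carrier R" "b \<in> carrier R"
  shows "right_bracket R n a b \<in> carrier R"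
  using assms by (simp add: right_bracket_def)

context ring_hom_ring
begin

lemma hom_minus:
  assumes "x \<in> carrier R" "y \<in> carrier R"
  shows "h (x \<ominus>\<^bsub>R\<^esub> y) = h x \<ominus>\<^bsub>S\<^esub> h y"
  using assms by (simp add: a_minus_def)

lemma hom_n_potent:
  assumes "n_potent R n x"
  shows "n_potent S n (h x)"
  using assms hom_nat_pow[of x n] by (auto simp: n_potent_def)

lemma hom_angle_bracket:
  assumes "a \<in> carrier R" "b \<in> carrier R"
  shows "h (angle_bracket R n a b) = angle_bracket S n (h a) (h b)"
  using assms by (simp add: angle_bracket_def hom_minus hom_nat_pow)

lemma hom_left_bracket:
  assumes "a \<in> carrier R" "b \<in> carrier R"
  shows "h (left_bracket R n a b) = left_bracket S n (h a) (h b)"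
  using assms by (simp add: left_bracket_def hom_minus hom_nat_pow)

lemma hom_right_bracket:
  assumes "a \<in> carrier R" "b \<in> carrier R"
  shows "h (right_bracket R n a b) = right_bracket S n (h a) (h b)"
  using assms by (simp add: right_bracket_def hom_minus hom_nat_pow)

lemma hom_Units:
  assumes "u \<in> Units R"
  shows "h u \<in> Units S"
proof -
  obtain v where v: "v \<in> carrier R" "u \<otimes>\<^bsub>R\<^esub> v = \<one>\<^bsub>R\<^esub>" "v \<otimes>\<^bsub>R\<^esub> u = \<one>\<^bsub>R\<^esub>"
    and u: "u \<in> carrier R"
    using assms by (auto simp: Units_def)
  then have "h u \<otimes>\<^bsub>S\<^esub> h v = \<one>\<^bsub>S\<^esub>" "h v \<otimes>\<^bsub>S\<^esub> h u = \<one>\<^bsub>S\<^esub>"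
    by (metis hom_mult hom_one)+
  with u v(1) show ?thesis
    by (auto simp: Units_def)
qed

lemma hom_property_K:
  assumes "property_K R n"
  shows "property_K S n"
proof -
  obtain a b where ab: "n_potent R n a" "n_potent R n b"
    "left_bracket R n a b \<in> Units R" "right_bracket R n a b \<in> Units R"
    using assms by (auto simp: property_K_def)
  moreover have "a \<in> carrier R" "b \<in> carrier R"
    using ab by (auto simp: n_potent_def)
  ultimately show ?thesis
    unfolding property_K_def by (metis hom_n_potent hom_Units hom_left_bracket hom_right_bracket)
qed

lemma hom_property_K_bar:
  assumes "property_K_bar R n"
  shows "property_K_bar S n"
proof -
  obtain a b where ab: "n_potent R n a" "n_potent R n b" "angle_bracket R n a b \<in> Units R"
    using assms by (auto simp: property_K_bar_def)
  moreover have "a \<in> carrier R" "b \<in> carrier R"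
    using ab by (auto simp: n_potent_def)
  ultimately show ?thesis
    unfolding property_K_bar_def by (metis hom_n_potent hom_Units hom_angle_bracket)
qed

end

context bimodule
begin

abbreviation "T \<equiv> triangular_ring S1 M S2"

lemma fst_ring_hom: "ring_hom_ring T S1 fst"
  by (rule ring_hom_ringI[OF ring_triangular_ring S1.ring_axioms])
    (auto simp: triangular_ring_def)

lemma snd_snd_ring_hom: "ring_hom_ring T S2 (snd \<circ> snd)"
  by (rule ring_hom_ringI[OF ring_triangular_ring S2.ring_axioms])
    (auto simp: triangular_ring_def)

text \<open>
  If \<open>r'\<close> and \<open>s'\<close> are the inverses of \<open>r\<close> and \<open>s\<close>, solving for the off-diagonal entry of a
  right inverse of \<open>(r, m, s)\<close> gives \<open>- r' m s'\<close>; the same entry also solves the equation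
  for a left inverse because the two actions commute.
\<close>
lemma Units_triangular_ringI:
  assumes r: "r \<in> Units S1" and m: "m \<in> carrier M" and s: "s \<in> Units S2"
  shows "(r, m, s) \<in> Units T"
proof -
  obtain r' where r': "r' \<in> carrier S1" "r \<otimes>\<^bsub>S1\<^esub> r' = \<one>\<^bsub>S1\<^esub>" "r' \<otimes>\<^bsub>S1\<^esub> r = \<one>\<^bsub>S1\<^esub>"
    and rc: "r \<in> carrier S1"
    using r by (auto simp: Units_def)
  obtain s' where s': "s' \<in> carrier S2" "s \<otimes>\<^bsub>S2\<^esub> s' = \<one>\<^bsub>S2\<^esub>" "s' \<otimes>\<^bsub>S2\<^esub> s = \<one>\<^bsub>S2\<^esub>"
    and sc: "s \<in> carrier S2"
    using s by (auto simp: Units_def)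
  define w where "w = r' \<odot>\<^bsub>M\<^esub> rsmult M m s'"
  have ms': "rsmult M m s' \<in> carrier M"
    using m s' by (simp add: rsmult_closed)
  have w: "w \<in> carrier M"
    unfolding w_def using r' ms' by (simp add: smult_closed)
  have rw: "r \<odot>\<^bsub>M\<^esub> w = rsmult M m s'"
    unfolding w_def using rc r' ms' by (simp add: smult_one flip: smult_assoc)
  have "rsmult M (rsmult M m s') s = m"
    using m sc s' by (simp add: rsmult_one flip: rsmult_assoc)
  then have ws: "rsmult M w s = r' \<odot>\<^bsub>M\<^esub> m"
    unfolding w_def using r' ms' sc by (simp add: smult_rsmult)
  have "r \<odot>\<^bsub>M\<^esub> (\<ominus>\<^bsub>M\<^esub> w) \<oplus>\<^bsub>M\<^esub> r \<odot>\<^bsub>M\<^esub> w = r \<odot>\<^bsub>M\<^esub> (\<ominus>\<^bsub>M\<^esub> w \<oplus>\<^bsub>M\<^esub> w)"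
    using rc w by (simp add: smult_r_distr)
  then have right: "r \<odot>\<^bsub>M\<^esub> (\<ominus>\<^bsub>M\<^esub> w) \<oplus>\<^bsub>M\<^esub> rsmult M m s' = \<zero>\<^bsub>M\<^esub>"
    using rc w by (simp add: rw M.l_neg smult_zero)
  have "rsmult M w s \<oplus>\<^bsub>M\<^esub> rsmult M (\<ominus>\<^bsub>M\<^esub> w) s = rsmult M (w \<oplus>\<^bsub>M\<^esub> \<ominus>\<^bsub>M\<^esub> w) s"
    using sc w by (simp add: rsmult_l_distr)
  then have left: "r' \<odot>\<^bsub>M\<^esub> m \<oplus>\<^bsub>M\<^esub> rsmult M (\<ominus>\<^bsub>M\<^esub> w) s = \<zero>\<^bsub>M\<^esub>"
    using sc w by (simp add: ws M.r_neg rsmult_zero)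
  have "(r', \<ominus>\<^bsub>M\<^esub> w, s') \<in> carrier T" "(r, m, s) \<in> carrier T"
    "(r, m, s) \<otimes>\<^bsub>T\<^esub> (r', \<ominus>\<^bsub>M\<^esub> w, s') = \<one>\<^bsub>T\<^esub>"
    "(r', \<ominus>\<^bsub>M\<^esub> w, s') \<otimes>\<^bsub>T\<^esub> (r, m, s) = \<one>\<^bsub>T\<^esub>"
    using r' s' rc sc m w left right by (simp_all add: triangular_ring_def)
  then show ?thesis
    unfolding Units_def by blast
qed

lemma Units_triangular_ring_iff:
  assumes "x \<in> carrier T"
  shows "x \<in> Units T \<longleftrightarrow> fst x \<in> Units S1 \<and> (snd \<circ> snd) x \<in> Units S2"
proof
  assume "x \<in> Units T"
  then show "fst x \<in> Units S1 \<and> (snd \<circ> snd) x \<in> Units S2"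
    using ring_hom_ring.hom_Units[OF fst_ring_hom] ring_hom_ring.hom_Units[OF snd_snd_ring_hom]
    by blast
next
  assume "fst x \<in> Units S1 \<and> (snd \<circ> snd) x \<in> Units S2"
  then show "x \<in> Units T"
    using assms Units_triangular_ringI[of "fst x" "fst (snd x)" "snd (snd x)"]
    by (auto simp: triangular_ring_def)
qed

lemma diagonal_nat_pow:
  assumes "r \<in> carrier S1" "s \<in> carrier S2"
  shows "(r, \<zero>\<^bsub>M\<^esub>, s) [^]\<^bsub>T\<^esub> (n::nat) = (r [^]\<^bsub>S1\<^esub> n, \<zero>\<^bsub>M\<^esub>, s [^]\<^bsub>S2\<^esub> n)"
  using assms by (induction n) (simp_all add: triangular_ring_def smult_zero rsmult_zero)

lemma diagonal_n_potent:
  assumes "n_potent S1 n r" "n_potent S2 n s"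
  shows "n_potent T n (r, \<zero>\<^bsub>M\<^esub>, s)"
  using assms by (simp add: n_potent_def diagonal_nat_pow) (simp add: triangular_ring_def)

lemma property_K_triangular_ring_iff:
  "property_K T n \<longleftrightarrow> property_K S1 n \<and> property_K S2 n"
proof
  assume "property_K T n"
  then show "property_K S1 n \<and> property_K S2 n"
    using ring_hom_ring.hom_property_K[OF fst_ring_hom]
      ring_hom_ring.hom_property_K[OF snd_snd_ring_hom] by blast
next
  assume "property_K S1 n \<and> property_K S2 n"
  then obtain a1 b1 a2 b2 where
    1: "n_potent S1 n a1" "n_potent S1 n b1"
      "left_bracket S1 n a1 b1 \<in> Units S1" "right_bracket S1 n a1 b1 \<in> Units S1" and
    2: "n_potent S2 n a2" "n_potent S2 n b2"
      "left_bracket S2 n a2 b2 \<in> Units S2" "right_bracket S2 n a2 b2 \<in> Units S2"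
    unfolding property_K_def by blast
  define a b where "a = (a1, \<zero>\<^bsub>M\<^esub>, a2)" and "b = (b1, \<zero>\<^bsub>M\<^esub>, b2)"
  have ab: "n_potent T n a" "n_potent T n b"
    unfolding a_def b_def using 1 2 by (simp_all add: diagonal_n_potent)
  then have carr: "a \<in> carrier T" "b \<in> carrier T"
    by (auto simp: n_potent_def)
  have "left_bracket T n a b \<in> Units T"
    using carr 1 2 unfolding
      Units_triangular_ring_iff[OF ring.left_bracket_closed[OF ring_triangular_ring carr]]
      ring_hom_ring.hom_left_bracket[OF fst_ring_hom carr]
      ring_hom_ring.hom_left_bracket[OF snd_snd_ring_hom carr]
    by (simp add: a_def b_def)
  moreover have "right_bracket T n a b \<in> Units T"
    using carr 1 2 unfolding
      Units_triangular_ring_iff[OF ring.right_bracket_closed[OF ring_triangular_ring carr]]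
      ring_hom_ring.hom_right_bracket[OF fst_ring_hom carr]
      ring_hom_ring.hom_right_bracket[OF snd_snd_ring_hom carr]
    by (simp add: a_def b_def)
  ultimately show "property_K T n"
    unfolding property_K_def using ab by blast
qed

lemma property_K_bar_triangular_ring_iff:
  "property_K_bar T n \<longleftrightarrow> property_K_bar S1 n \<and> property_K_bar S2 n"
proof
  assume "property_K_bar T n"
  then show "property_K_bar S1 n \<and> property_K_bar S2 n"
    using ring_hom_ring.hom_property_K_bar[OF fst_ring_hom]
      ring_hom_ring.hom_property_K_bar[OF snd_snd_ring_hom] by blast
next
  assume "property_K_bar S1 n \<and> property_K_bar S2 n"
  then obtain a1 b1 a2 b2 where
    1: "n_potent S1 n a1" "n_potent S1 n b1" "angle_bracket S1 n a1 b1 \<in> Units S1" and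
    2: "n_potent S2 n a2" "n_potent S2 n b2" "angle_bracket S2 n a2 b2 \<in> Units S2"
    unfolding property_K_bar_def by blast
  define a b where "a = (a1, \<zero>\<^bsub>M\<^esub>, a2)" and "b = (b1, \<zero>\<^bsub>M\<^esub>, b2)"
  have ab: "n_potent T n a" "n_potent T n b"
    unfolding a_def b_def using 1 2 by (simp_all add: diagonal_n_potent)
  then have carr: "a \<in> carrier T" "b \<in> carrier T"
    by (auto simp: n_potent_def)
  have "angle_bracket T n a b \<in> Units T"
    using carr 1 2 unfolding
      Units_triangular_ring_iff[OF ring.angle_bracket_closed[OF ring_triangular_ring carr]]
      ring_hom_ring.hom_angle_bracket[OF fst_ring_hom carr]
      ring_hom_ring.hom_angle_bracket[OF snd_snd_ring_hom carr]
    by (simp add: a_def b_def)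
  then show "property_K_bar T n"
    unfolding property_K_bar_def using ab by blast
qed

end

theorem theorem3p8:
  fixes S1 :: "('a, 'x) ring_scheme"
    and S2 :: "('b, 'y) ring_scheme"
    and M :: "('a, 'b, 'm, 'z) bimodule_scheme"
  assumes "ring S1" and "ring S2" and "bimodule S1 S2 M"
  shows "(\<forall>n\<ge>2. property_K (triangular_ring S1 M S2) n
            \<longleftrightarrow> property_K S1 n \<and> property_K S2 n)
       \<and> (\<forall>n\<ge>2. property_K_bar (triangular_ring S1 M S2) n
            \<longleftrightarrow> property_K_bar S1 n \<and> property_K_bar S2 n)"
  using bimodule.property_K_triangular_ring_iff[OF assms(3)]
    bimodule.property_K_bar_triangular_ring_iff[OF assms(3)]
  by blast

end
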